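(* Let $w\in S_n$ be a permutation, and for $(x,y)\in\mathrm{Inv}(w^{-1})$ let $R_{xy}(w)=\#\{i<w^{-1}(y): w(i)\le x\}$. Then $$1+\sum_{(x,y)\in\mathrm{Inv}(w^{-1})}R_{xy}(w)\ \le\ \#\mathrm{RPD}(w)\ \le\ \prod_{(x,y)\in\mathrm{Inv}(w^{-1})}\bigl(R_{xy}(w)+1\bigr).$$
   Context: A pipe dream is a finite subset $D\subset \mathbb{Z}_{>0}\times\mathbb{Z}_{>0}$, in matrix coordinates ($(i,j)$ is row $i$ from the top, column $j$ from the left). Place a cross tile at each $(i,j)\in D$ (one strand joins the left and right edges, the other joins the top and bottom edges) and a bump tile at each $(i,j)\notin D$ (one strand joins the top edge to the left edge, the other joins the right edge to the bottom edge). The strands form pipes going from the top boundary to the left boundary; pipe $x$ is the one entering at the top of column $x$. The permutation $w$ of $D$ is defined by: $w(i)$ is the label of the pipe that exits the left boundary in row $i$. Permutations $w\in S_n$ are regarded as permutations of $\mathbb{Z}_{>0}$ fixing all $m>n$. $\mathrm{RPD}(w)$ is the set of reduced pipe dreams for $w$: pipe dreams $D$ whose permutation is $w$ and such that $|D|$ equals the number of inversions of $w$. $\mathrm{Inv}(w^{-1})=\{(x,y)\in[n]^2: x<y,\ w^{-1}(x)>w^{-1}(y)\}$. *)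

theory Defs
  imports "HOL-Combinatorics.Permutations"
begin

text \<open>
  Rows and columns of the grid are indexed by positive naturals. An edge of the grid is
  \<open>Hor i j\<close>, the bottom edge of tile (i,j) (so \<open>Hor 0 j\<close> is the top boundary of column j), or
  \<open>Ver i j\<close>, the right edge of tile (i,j) (so \<open>Ver i 0\<close> is the left boundary of row i).
\<close>

datatype edge = Hor nat nat | Ver nat nat

text \<open>
  Pipe x runs through a given edge. Every pipe moves down or to the left, so each tile
  is entered through its top or right edge and left through its bottom or left edge.
\<close>

inductive on_pipe :: "(nat \<times> nat) set \<Rightarrow> nat \<Rightarrow> edge \<Rightarrow> bool" for D x where
  enter: "1 \<le> x \<Longrightarrow> on_pipe D x (Hor 0 x)"
| cross_top: "on_pipe D x (Hor i j) \<Longrightarrow> (Suc i, j) \<in> D \<Longrightarrow> on_pipe D x (Hor (Suc i) j)"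
| cross_right: "on_pipe D x (Ver i (Suc j)) \<Longrightarrow> (i, Suc j) \<in> D \<Longrightarrow> on_pipe D x (Ver i j)"
| bump_top: "on_pipe D x (Hor i (Suc j)) \<Longrightarrow> (Suc i, Suc j) \<notin> D \<Longrightarrow> on_pipe D x (Ver (Suc i) j)"
| bump_right: "on_pipe D x (Ver i (Suc j)) \<Longrightarrow> (i, Suc j) \<notin> D \<Longrightarrow> on_pipe D x (Hor i (Suc j))"

definition pipe_dream :: "(nat \<times> nat) set \<Rightarrow> bool" where
  "pipe_dream D \<longleftrightarrow> finite D \<and> D \<subseteq> {1..} \<times> {1..}"

text \<open>
  Permutations of the positive integers are functions on the naturals that fix 0.
  The description below is proper for every pipe dream, see \<open>ex1_exiting_pipe\<close>.
\<close>

definition pd_perm :: "(nat \<times> nat) set \<Rightarrow> nat \<Rightarrow> nat" where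
  "pd_perm D i = (if i = 0 then 0 else (THE x. on_pipe D x (Ver i 0)))"

definition inversions_on :: "nat set \<Rightarrow> (nat \<Rightarrow> nat) \<Rightarrow> (nat \<times> nat) set" where
  "inversions_on A u = {(x, y) \<in> A \<times> A. x < y \<and> u x > u y}"

definition RPD :: "(nat \<Rightarrow> nat) \<Rightarrow> (nat \<times> nat) set set" where
  "RPD w = {D. pipe_dream D \<and> pd_perm D = w \<and> card D = card (inversions_on {1..} w)}"

definition R :: "(nat \<Rightarrow> nat) \<Rightarrow> nat \<Rightarrow> nat \<Rightarrow> nat" where
  "R w x y = card {i \<in> {1..}. i < inv w y \<and> w i \<le> x}"

lemma not_on_pipe_Ver_0: "\<not> on_pipe D x (Ver 0 k)"
proof
  have False if "on_pipe D x e" "e = Ver 0 k" for e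
    using that by (induction arbitrary: k rule: on_pipe.induct) auto
  then show "on_pipe D x (Ver 0 k) \<Longrightarrow> False" by blast
qed

lemma on_pipe_unique:
  assumes "on_pipe D x e" "on_pipe D y e"
  shows "x = y"
  using assms
proof (induction rule: on_pipe.induct)
  case enter
  from enter.prems show ?case
    by (cases rule: on_pipe.cases) (auto simp: not_on_pipe_Ver_0)
next
  case (cross_top i j)
  from cross_top.prems cross_top.hyps show ?case
    by (cases rule: on_pipe.cases) (auto intro: cross_top.IH)
next
  case (cross_right i j)
  from cross_right.prems cross_right.hyps show ?case
    by (cases rule: on_pipe.cases) (auto intro: cross_right.IH)
next
  case (bump_top i j)
  from bump_top.prems bump_top.hyps show ?case
    by (cases rule: on_pipe.cases) (auto intro: bump_top.IH)
next
  case (bump_right i j)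
  from bump_right.prems bump_right.hyps show ?case
    by (cases rule: on_pipe.cases) (auto intro: bump_right.IH simp: not_on_pipe_Ver_0)
qed

lemma ex1_exiting_pipe:
  assumes "pipe_dream D" "1 \<le> i"
  shows "\<exists>!x. on_pipe D x (Ver i 0)"
proof -
  obtain N where N: "\<And>i j. (i, j) \<in> D \<Longrightarrow> j \<le> N"
    using assms(1) finite_nat_set_iff_bounded_le[of "snd ` D"]
    unfolding pipe_dream_def by force
  have ver: "\<exists>x. on_pipe D x (Ver (Suc i) j)"
    if hor: "\<And>j. 1 \<le> j \<Longrightarrow> \<exists>x. on_pipe D x (Hor i j)" for i j
  proof (induction "N - j" arbitrary: j)
    case 0
    then have "(Suc i, Suc j) \<notin> D" using N by fastforce
    then show ?case using hor[of "Suc j"] bump_top by force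
  next
    case (Suc k)
    then have "\<exists>x. on_pipe D x (Ver (Suc i) (Suc j))" by simp
    then show ?case
      using hor[of "Suc j"] bump_top[of D _ i j] cross_right[of D _ "Suc i" j]
      by (cases "(Suc i, Suc j) \<in> D") auto
  qed
  have hor: "\<exists>x. on_pipe D x (Hor i j)" if "1 \<le> j" for i j
    using that
  proof (induction i arbitrary: j)
    case 0
    then show ?case using enter by blast
  next
    case (Suc i)
    obtain k where k: "j = Suc k" using Suc.prems by (cases j) auto
    show ?case
      using Suc.IH[OF Suc.prems] ver[OF Suc.IH, of j] cross_top[of D _ i j]
        bump_right[of D _ "Suc i" k] k
      by (cases "(Suc i, j) \<in> D") auto
  qed
  obtain k where "i = Suc k" using assms(2) by (cases i) auto
  then show ?thesis using ver[OF hor] on_pipe_unique by blast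
qed

end

theory Submission imports Defs "HOL-Library.FuncSet" begin

text \<open>
  In a reduced pipe dream the crosses correspond to the inversions \<open>(x, y)\<close>, with \<open>x\<close> the vertical
  and \<open>y\<close> the horizontal pipe.

  Upper bound: a pipe dream is determined by the sets of columns that the pipes \<open>y\<close> cross
  horizontally, since these decide the tiles diagonal by diagonal from the northeast. If
  \<open>x\<^sub>1 < x\<^sub>2 < \<dots>\<close> are the pipes inverted with \<open>y\<close>, the \<open>m\<close>-th smallest of these columns lies
  between \<open>m\<close> and \<open>x\<^sub>m\<close>, because pipe \<open>x\<close> never moves right of column \<open>x\<close>, and
  \<open>R\<close> equals \<open>x\<^sub>m - m\<close> at \<open>(x\<^sub>m, y)\<close>.

  Lower bound: a reduced pipe dream that is not left-justified admits an inverse ladder move (Bergeron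
  and Billey), which lowers the sum of the columns of its crosses by one. So all values between the
  sum for the left-justified and the sum for the top-justified pipe dream are attained, and these two
  differ by the sum of \<open>R\<close>.
\<close>

section \<open>Following a pipe edge by edge\<close>

text \<open>The four step rules of \<open>on_pipe\<close> as one function, so that two pipes, or one
  pipe in two pipe dreams, can be followed simultaneously. At column 0 the truncated
  \<open>j - 1\<close> has no geometric meaning, hence the recurring guard
  \<open>1 \<le> edge_column e\<close>.\<close>

fun next_edge :: "(nat \<times> nat) set \<Rightarrow> edge \<Rightarrow> edge" where
  "next_edge D (Hor i j) = (if (Suc i, j) \<in> D then Hor (Suc i) j else Ver (Suc i) (j - 1))"
| "next_edge D (Ver i j) = (if (i, j) \<in> D then Ver i (j - 1) else Hor i j)"

fun edge_column :: "edge \<Rightarrow> nat" where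
  "edge_column (Hor i j) = j"
| "edge_column (Ver i j) = j"

lemma on_pipe_Hor_ge_1: "on_pipe D x (Hor i j) \<Longrightarrow> 1 \<le> j"
  by (induction "Hor i j" arbitrary: i j rule: on_pipe.induct) auto

lemma on_pipe_Ver_ge_1: "on_pipe D x (Ver i j) \<Longrightarrow> 1 \<le> i"
  using not_on_pipe_Ver_0[of D x j] by (cases i) auto

lemma on_pipe_next_edge:
  assumes "on_pipe D x e" "1 \<le> edge_column e"
  shows "on_pipe D x (next_edge D e)"
proof (cases e)
  case (Hor i j)
  then obtain k where "j = Suc k" using assms(2) by (cases j) auto
  then show ?thesis using Hor assms(1) by (auto intro: cross_top bump_top)
next
  case (Ver i j)
  then obtain k where "j = Suc k" using assms(2) by (cases j) auto
  then show ?thesis using Ver assms(1) by (auto intro: cross_right bump_right)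
qed

lemma on_pipe_cases_next_edge:
  assumes "on_pipe D x f"
  obtains "f = Hor 0 x" "1 \<le> x"
  | e where "on_pipe D x e" "1 \<le> edge_column e" "f = next_edge D e"
  using assms
proof (cases rule: on_pipe.cases)
  case (cross_top i j)
  then show ?thesis using that(2)[of "Hor i j"] on_pipe_Hor_ge_1[of D x i j] by simp
next
  case (cross_right i j)
  then show ?thesis using that(2)[of "Ver i (Suc j)"] by simp
next
  case (bump_top i j)
  then show ?thesis using that(2)[of "Hor i (Suc j)"] by simp
next
  case (bump_right i j)
  then show ?thesis using that(2)[of "Ver i (Suc j)"] by simp
qed

lemma on_pipe_induct_next_edge [consumes 1, case_names enter step]:
  assumes "on_pipe D x f"
    and "1 \<le> x \<Longrightarrow> P (Hor 0 x)"
    and step: "\<And>e. on_pipe D x e \<Longrightarrow> 1 \<le> edge_column e \<Longrightarrow> P e \<Longrightarrow> P (next_edge D e)"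
  shows "P f"
  using assms(1)
proof (induction rule: on_pipe.induct)
  case enter
  then show ?case by (rule assms(2))
next
  case (cross_top i j)
  then show ?case using step[of "Hor i j"] on_pipe_Hor_ge_1[of D x i j] by simp
next
  case (cross_right i j)
  then show ?case using step[of "Ver i (Suc j)"] by simp
next
  case (bump_top i j)
  then show ?case using step[of "Hor i (Suc j)"] by simp
next
  case (bump_right i j)
  then show ?case using step[of "Ver i (Suc j)"] by simp
qed

text \<open>
  The diagonal \<open>j - i\<close> of the tile that is left through the edge. It drops by one in every step of a
  pipe, so the edges of different pipes can be compared on a common diagonal.
\<close>

fun content :: "edge \<Rightarrow> int" where
  "content (Hor i j) = int j - int i"
| "content (Ver i j) = int j - int i + 1"

lemma content_next_edge [simp]:
  "1 \<le> edge_column e \<Longrightarrow> content (next_edge D e) = content e - 1"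
  by (cases e) auto

lemma on_pipe_content_le: "on_pipe D x e \<Longrightarrow> content e \<le> int x"
  by (induction rule: on_pipe_induct_next_edge) auto

lemma on_pipe_at_content:
  assumes "on_pipe D x e" "content e \<le> c" "c \<le> int x"
  shows "\<exists>f. on_pipe D x f \<and> content f = c"
  using assms
proof (induction rule: on_pipe_induct_next_edge)
  case enter
  then show ?case by (intro exI[of _ "Hor 0 x"]) (auto intro: on_pipe.enter)
next
  case (step e)
  then show ?case
    using on_pipe_next_edge[OF step.hyps] by (cases "c = content e - 1") auto
qed

text \<open>Every step lowers \<open>content\<close> by one from its initial value \<open>x\<close>,
  so \<open>content\<close> parametrizes the edges of a pipe.\<close>

lemma on_pipe_same_content:
  assumes "on_pipe D x e" "on_pipe D x f" "content e = content f"
  shows "e = f"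
  using assms
proof (induction arbitrary: f rule: on_pipe_induct_next_edge)
  case enter
  from enter.prems(1) show ?case
    by (cases rule: on_pipe_cases_next_edge)
      (use enter.prems in \<open>auto dest: on_pipe_content_le\<close>)
next
  case (step e)
  from step.prems(1) show ?case
  proof (cases rule: on_pipe_cases_next_edge)
    case 1
    then show ?thesis using step.prems step.hyps on_pipe_content_le[OF step.hyps(1)] by simp
  next
    case (2 e')
    then show ?thesis using step.prems step.hyps step.IH[of e'] by simp
  qed
qed

text \<open>Twice the horizontal coordinate of the midpoint of the edge; the doubling keeps bottom
  edges, which lie between two vertical grid lines, integral.\<close>

fun half_column :: "edge \<Rightarrow> int" where
  "half_column (Hor i j) = 2 * int j - 1"
| "half_column (Ver i j) = 2 * int j"

text \<open>No step of a pipe raises \<open>half_column\<close>, and a step out of a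
  \<open>Ver\<close> edge lowers it strictly.\<close>

lemma half_column_less_after_Ver:
  assumes "on_pipe D x e" "on_pipe D x (Ver i j)" "content e < content (Ver i j)"
  shows "half_column e < 2 * int j"
  using assms
proof (induction rule: on_pipe_induct_next_edge)
  case enter
  then show ?case using on_pipe_content_le[of D x "Ver i j"] by simp
next
  case (step e)
  show ?case
  proof (cases "content e = content (Ver i j)")
    case True
    then have "e = Ver i j" using on_pipe_same_content step.hyps(1) step.prems(1) by blast
    then show ?thesis using step.hyps by auto
  next
    case False
    then have "half_column e < 2 * int j" using step by simp
    then show ?thesis using step.hyps by (cases e) auto
  qed
qed

lemma on_pipe_Ver_unique:
  assumes "on_pipe D x (Ver i j)" "on_pipe D x (Ver k j)"
  shows "i = k"
  using half_column_less_after_Ver[OF assms(1,2)] half_column_less_after_Ver[OF assms(2,1)]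
  by (cases i k rule: linorder_cases) auto

section \<open>Relative position of two pipes and their crossings\<close>

text \<open>The position from northwest to southeast among the edges of equal content.\<close>

fun depth :: "edge \<Rightarrow> int" where
  "depth (Hor i j) = 2 * int i + 1"
| "depth (Ver i j) = 2 * int i"

definition crosses :: "(nat \<times> nat) set \<Rightarrow> nat \<Rightarrow> nat \<Rightarrow> nat \<times> nat \<Rightarrow> bool" where
  "crosses D x y t \<longleftrightarrow> (case t of (i, j) \<Rightarrow>
     t \<in> D \<and> 1 \<le> i \<and> on_pipe D x (Hor (i - 1) j) \<and> on_pipe D y (Ver i j))"

lemma crosses_unique:
  assumes "crosses D x y t" "crosses D x' y' t"
  shows "x = x'" "y = y'"
  using assms on_pipe_unique unfolding crosses_def by (auto split: prod.splits)

text \<open>Since a pipe has at most one \<open>Ver\<close> edge in each column, this set has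
  exactly one element per horizontal cross of \<open>y\<close>.\<close>

definition columns :: "(nat \<times> nat) set \<Rightarrow> nat \<Rightarrow> nat set" where
  "columns D y = {j. \<exists>i. (i, j) \<in> D \<and> on_pipe D y (Ver i j)}"

text \<open>Edges of equal content lead into tiles of one diagonal. If the tiles differ, their rows
  decide the order after the step too; if both edges enter the same tile, a bump keeps the order and
  only a cross reverses it, which the last hypothesis excludes.\<close>

lemma depth_next_edge_less:
  assumes "depth e < depth f" "content e = content f" "1 \<le> edge_column e" "1 \<le> edge_column f"
    and "\<And>i j. e = Hor i j \<Longrightarrow> f = Ver (Suc i) j \<Longrightarrow> (Suc i, j) \<notin> D"
  shows "depth (next_edge D e) < depth (next_edge D f)"
proof (cases e)
  case e: (Hor i j)
  show ?thesis
  proof (cases f)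
    case f: (Hor k l)
    then have "i < k" using e assms(1) by simp
    then show ?thesis using e f by auto
  next
    case f: (Ver k l)
    show ?thesis
    proof (cases "k = Suc i")
      case True
      then have "l = j" using assms(2) e f by simp
      then show ?thesis using e f True assms(5) by simp
    next
      case False
      then show ?thesis using e f assms by auto
    qed
  qed
next
  case (Ver i j)
  then show ?thesis using assms by (cases f) auto
qed

lemma depth_less_if_not_crossing:
  assumes "on_pipe D x e" "on_pipe D y f" "content e = content f" "x < y"
    and nc: "\<And>t. \<not> crosses D x y t"
  shows "depth e < depth f"
  using assms(1,2,3)
proof (induction arbitrary: f rule: on_pipe_induct_next_edge)
  case enter
  \<comment> \<open>On this diagonal \<open>Hor 0 x\<close> is the only edge of minimal depth 1, so
    it suffices that \<open>y\<close> avoids it.\<close>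
  have "f \<noteq> Hor 0 x"
    using on_pipe_unique[of D x f y] on_pipe.enter[OF \<open>1 \<le> x\<close>] enter.prems \<open>x < y\<close> by auto
  then show ?case
    using enter.prems on_pipe_Ver_ge_1[of D y] by (cases f) (auto simp: Suc_le_eq, force)
next
  case (step e)
  from step.prems(1) show ?case
  proof (cases rule: on_pipe_cases_next_edge)
    case 1
    then show ?thesis
      using step.prems step.hyps on_pipe_content_le[OF step.hyps(1)] \<open>x < y\<close> by simp
  next
    case (2 f')
    have eq: "content e = content f'" using step.prems step.hyps 2 by simp
    have "(Suc i, j) \<notin> D" if "e = Hor i j" "f' = Ver (Suc i) j" for i j
      using nc[of "(Suc i, j)"] that 2(1) step.hyps(1) by (auto simp: crosses_def)
    with step.IH[OF 2(1) eq] eq step.hyps(2) 2 show ?thesis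
      by (simp add: depth_next_edge_less)
  qed
qed

text \<open>Without a crossing, \<open>x\<close> stays northwest of \<open>y\<close> on every common
  diagonal. But \<open>Ver b 0\<close>, where \<open>y\<close> exits, is already the
  northwesternmost edge on its diagonal that a pipe can use, and \<open>x\<close> still passes that
  diagonal because it exits further down.\<close>

lemma inverted_pipes_cross:
  assumes "on_pipe D x (Ver a 0)" "on_pipe D y (Ver b 0)" "x < y" "b < a"
  shows "\<exists>t. crosses D x y t"
proof (rule ccontr)
  assume "\<nexists>t. crosses D x y t"
  then have nc: "\<And>t. \<not> crosses D x y t" by blast
  have "1 \<le> b" using on_pipe_Ver_ge_1[OF assms(2)] .
  then obtain e where e: "on_pipe D x e" "content e = content (Ver b 0)"
    using on_pipe_at_content[OF assms(1), of "content (Ver b 0)"] \<open>b < a\<close> by auto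
  have "depth e < depth (Ver b 0)"
    using depth_less_if_not_crossing[OF e(1) assms(2) e(2) assms(3) nc] .
  then show False
    using e on_pipe_Hor_ge_1[of D x] by (cases e) force+
qed

section \<open>Pipes after a change of the pipe dream\<close>

text \<open>To reach an edge a pipe only visits tiles whose diagonal is at least the content of that
  edge.\<close>

lemma on_pipe_transfer:
  assumes "on_pipe D x e" "content e > c"
    and agree: "\<And>i j. int j - int i > c \<Longrightarrow> (i, j) \<in> D \<longleftrightarrow> (i, j) \<in> D'"
  shows "on_pipe D' x e"
  using assms(1,2)
proof (induction rule: on_pipe_induct_next_edge)
  case enter
  then show ?case by (auto intro: on_pipe.enter)
next
  case (step e)
  have "next_edge D e = next_edge D' e"
    using step.hyps(2) step.prems agree by (cases e) auto
  then show ?case using step on_pipe_next_edge[of D' x e] by simp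
qed

text \<open>
  An inverse ladder move replaces the cross at \<open>(a, Suc j)\<close> by one at \<open>(b, j)\<close>. It exchanges the two
  pipes running down columns \<open>j\<close> and \<open>Suc j\<close> inside the ladder; \<open>ladder_edge\<close> maps an edge of a pipe
  before the move to one of the same pipe after it.
\<close>

definition ladder_edge :: "nat \<Rightarrow> nat \<Rightarrow> nat \<Rightarrow> edge \<Rightarrow> edge" where
  "ladder_edge a b j e = (case e of
     Hor r c \<Rightarrow> if a \<le> r \<and> r < b \<and> c = j then Hor r (Suc j)
                else if a \<le> r \<and> r < b \<and> c = Suc j then Hor r j else e
   | Ver r c \<Rightarrow> if c = j \<and> r = a then Hor a (Suc j)
                else if c = j \<and> r = b then Hor (b - 1) j else e)"

text \<open>Each step of the pipe in \<open>D\<close> is matched by steps in \<open>D'\<close>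
  between the \<open>ladder_edge\<close> images. One step suffices except at the corners of the
  ladder: two are needed from \<open>Hor (a - 1) (Suc j)\<close> and \<open>Hor (b - 1) j\<close>,
  none from \<open>Ver a j\<close> and \<open>Hor (b - 1) (Suc j)\<close>. As
  \<open>1 \<le> j\<close>, edges on the left boundary are their own images, so exits are
  preserved.\<close>

lemma on_pipe_inverse_ladder:
  assumes "a < b" "1 \<le> j" "1 \<le> a"
    and ul: "(a, j) \<notin> D" "(a, Suc j) \<in> D" and ll: "(b, j) \<notin> D" "(b, Suc j) \<notin> D"
    and mid: "\<And>r. a < r \<Longrightarrow> r < b \<Longrightarrow> (r, j) \<in> D \<and> (r, Suc j) \<in> D"
    and D': "D' = insert (b, j) (D - {(a, Suc j)})"
    and "on_pipe D x e"
  shows "on_pipe D' x (ladder_edge a b j e)"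
  using assms(10)
proof (induction rule: on_pipe_induct_next_edge)
  case enter
  then show ?case using assms(3) by (auto simp: ladder_edge_def intro: on_pipe.enter)
next
  case (step e)
  have j: "j - Suc 0 \<noteq> j" using assms(2) by simp
  have next2: "on_pipe D' x (next_edge D' (next_edge D' f))"
    if "on_pipe D' x f" "1 \<le> edge_column f" "1 \<le> edge_column (next_edge D' f)" for f
    using that by (intro on_pipe_next_edge)
  note IH = step.IH
  note nx = on_pipe_next_edge[OF IH]
  show ?case
  proof (cases e)
    case e: (Hor r c)
    then have c: "1 \<le> c" using step.hyps by simp
    consider "c = j" "a \<le> r" "Suc r < b" | "c = j" "Suc r = b" | "c = Suc j" "a \<le> r" "Suc r < b"
      | "c = Suc j" "Suc r = b" | "c = Suc j" "Suc r = a" | "c = j" "Suc r = a"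
      | "c \<noteq> j" "c \<noteq> Suc j" | "c = j \<or> c = Suc j" "Suc r < a \<or> b \<le> r"
      by linarith
    then show ?thesis
    proof cases
      case 1
      then show ?thesis using nx e mid[of "Suc r"] by (simp add: ladder_edge_def D')
    next
      case 2
      then show ?thesis using next2[of "Hor r (Suc j)"] e IH assms(1,2) ll j
        by (simp add: ladder_edge_def D')
    next
      case 3
      then show ?thesis using nx e mid[of "Suc r"] assms(2) by (simp add: ladder_edge_def D')
    next
      case 4
      then show ?thesis using e IH assms(1) ll by (auto simp: ladder_edge_def)
    next
      case 5
      then have "ladder_edge a b j e = e" using e by (simp add: ladder_edge_def)
      then show ?thesis using next2[of e] 5 e IH assms(1,2) ul by (simp add: ladder_edge_def D')
    next
      case 6
      then have "ladder_edge a b j e = e" using e by (simp add: ladder_edge_def)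
      then show ?thesis using nx 6 e assms(1,2) ul j by (simp add: ladder_edge_def D')
    next
      case 7
      have "next_edge D' e = next_edge D e" "ladder_edge a b j e = e"
        using 7 e assms(1) by (auto simp: ladder_edge_def D')
      moreover have "ladder_edge a b j (next_edge D e) = next_edge D e"
        using 7 e assms(1) c by (auto simp: ladder_edge_def)
      ultimately show ?thesis using nx step.hyps by simp
    next
      case 8
      have "next_edge D' e = next_edge D e" "ladder_edge a b j e = e"
        using 8 e assms(1) by (auto simp: ladder_edge_def D')
      moreover have "ladder_edge a b j (next_edge D e) = next_edge D e"
        using 8 e assms(1) c by (auto simp: ladder_edge_def)
      ultimately show ?thesis using nx step.hyps by simp
    qed
  next
    case e: (Ver r c)
    then have c: "1 \<le> c" using step.hyps by simp
    consider "c = j" "r = a" | "c = j" "r = b" | "c = j" "r \<noteq> a" "r \<noteq> b" | "c = Suc j" "r = a"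
      | "c = Suc j" "a < r" "r < b" | "c = Suc j" "r = b" | "c = Suc j" "r < a \<or> b < r"
      | "c \<noteq> j" "c \<noteq> Suc j"
      by linarith
    then show ?thesis
    proof cases
      case 1
      then show ?thesis using e IH assms(1) ul by (simp add: ladder_edge_def)
    next
      case 2
      then have "ladder_edge a b j e = Hor (b - 1) j" "Suc (b - 1) = b"
        using e assms(1) by (auto simp: ladder_edge_def)
      then show ?thesis using nx 2 e ll c by (simp add: ladder_edge_def D')
    next
      case 3
      have "next_edge D' e = next_edge D e" "ladder_edge a b j e = e" using 3 e by (auto simp: ladder_edge_def D')
      moreover have "ladder_edge a b j (next_edge D e) = next_edge D e"
        using 3 e mid[of r] j by (auto simp: ladder_edge_def)
      ultimately show ?thesis using nx step.hyps by simp
    next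
      case 4
      then show ?thesis using nx e assms(1) ul by (simp add: ladder_edge_def D')
    next
      case 5
      then show ?thesis using nx e mid[of r] by (simp add: ladder_edge_def D')
    next
      case 6
      then show ?thesis using nx e assms(1) ll by (simp add: ladder_edge_def D')
    next
      case 7
      have "next_edge D' e = next_edge D e" "ladder_edge a b j e = e"
        using 7 e assms(1) by (auto simp: ladder_edge_def D')
      moreover have "ladder_edge a b j (next_edge D e) = next_edge D e"
        using 7 e assms(1) by (auto simp: ladder_edge_def)
      ultimately show ?thesis using nx step.hyps by simp
    next
      case 8
      have "next_edge D' e = next_edge D e" "ladder_edge a b j e = e"
        using 8 e assms(1) by (auto simp: ladder_edge_def D')
      moreover have "ladder_edge a b j (next_edge D e) = next_edge D e"
        using 8 e assms(1) c by (auto simp: ladder_edge_def)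
      ultimately show ?thesis using nx step.hyps by simp
    qed
  qed
qed

lemma edge_column_le: "on_pipe D x e \<Longrightarrow> edge_column e \<le> x"
proof (induction rule: on_pipe_induct_next_edge)
  case (step e)
  then show ?case by (cases e) auto
qed simp

lemma pd_perm_eqI:
  assumes "pipe_dream D" "1 \<le> i" "on_pipe D x (Ver i 0)"
  shows "pd_perm D i = x"
  using assms ex1_exiting_pipe[OF assms(1,2)] unfolding pd_perm_def by auto

lemma on_pipe_pd_perm:
  assumes "pipe_dream D" "1 \<le> i"
  shows "on_pipe D (pd_perm D i) (Ver i 0)"
  using theI'[OF ex1_exiting_pipe[OF assms]] assms(2) unfolding pd_perm_def by simp

section \<open>Counting sets of positive integers below a given set\<close>

text \<open>The summand is the rank of \<open>x\<close> in \<open>X\<close>, and the ranks run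
  through 1 to \<open>card X\<close>.\<close>

lemma sum_card_atMost:
  fixes X :: "nat set"
  assumes "finite X"
  shows "(\<Sum>x\<in>X. card (X \<inter> {..x})) = \<Sum>{1..card X}"
  using assms
proof (induction rule: finite_linorder_max_induct)
  case (insert b A)
  have "(\<Sum>x\<in>A. card (insert b A \<inter> {..x})) = (\<Sum>x\<in>A. card (A \<inter> {..x}))"
    by (intro sum.cong refl arg_cong[of _ _ card]) (use insert.hyps in force)
  moreover have "insert b A \<inter> {..b} = insert b A" using insert.hyps by auto
  moreover have "b \<notin> A" using insert.hyps by auto
  ultimately show ?case using insert by simp
qed simp

lemma downward_closed_eq_atLeastAtMost:
  fixes C :: "nat set"
  assumes "finite C" "0 \<notin> C" "\<And>j. 1 \<le> j \<Longrightarrow> Suc j \<in> C \<Longrightarrow> j \<in> C"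
  shows "C = {1..card C}"
proof (cases "C = {}")
  case False
  have "j \<in> C" if "1 \<le> j" "j \<le> Max C" for j
    using that(2,1)
  proof (induction rule: inc_induct)
    case base
    show ?case using Max_in[OF assms(1) False] .
  next
    case (step j)
    then show ?case using assms(3)[of j] by simp
  qed
  moreover have "1 \<le> j \<and> j \<le> Max C" if "j \<in> C" for j
    using that assms(2) Max_ge[OF assms(1) that] by (cases j) auto
  ultimately have C: "C = {1..Max C}" by (metis atLeastAtMost_iff subsetI subset_antisym)
  have "card C = Max C" by (subst C) simp
  then show ?thesis using C by simp
qed simp

text \<open>For finite \<open>X\<close>, the counting condition says, without enumerating the sets,
  that the \<open>m\<close>-th smallest element of \<open>C\<close> is at most the
  \<open>m\<close>-th smallest of \<open>X\<close>.\<close>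

definition dominated :: "nat set \<Rightarrow> nat set set" where
  "dominated X = {C. finite C \<and> 0 \<notin> C \<and> card C = card X \<and>
     (\<forall>t. card (X \<inter> {..t}) \<le> card (C \<inter> {..t}))}"

text \<open>The bijection need not be increasing: it suffices that it maps the elements of
  \<open>X\<close> up to \<open>t\<close> injectively to elements of \<open>C\<close> up to
  \<open>t\<close>.\<close>

lemma dominatedI:
  assumes "finite X" "bij_betw f X C" "\<And>x. x \<in> X \<Longrightarrow> 1 \<le> f x \<and> f x \<le> x"
  shows "C \<in> dominated X"
proof -
  have C: "C = f ` X" and inj: "inj_on f X" using assms(2) by (auto simp: bij_betw_def)
  have "card (X \<inter> {..t}) \<le> card (C \<inter> {..t})" for t
  proof (rule card_inj_on_le)
    show "inj_on f (X \<inter> {..t})" using inj by (rule inj_on_subset) auto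
    show "f ` (X \<inter> {..t}) \<subseteq> C \<inter> {..t}" using assms(3) C by force
    show "finite (C \<inter> {..t})" using assms(1) C by simp
  qed
  moreover have "card C = card X" using bij_betw_same_card[OF assms(2)] by simp
  moreover have "0 \<notin> C" using assms(3) C by fastforce
  ultimately show ?thesis using assms(1) C by (simp add: dominated_def)
qed

lemma dominated_insert_Max:
  assumes "finite A" "\<forall>a\<in>A. a < b" "C \<in> dominated (insert b A)"
  shows "C \<noteq> {}" "Max C \<in> {card A + 1..b}" "C - {Max C} \<in> dominated A"
proof -
  have "b \<notin> A" using assms(2) by auto
  have fin: "finite C" and "0 \<notin> C" and card: "card C = Suc (card A)"
    and le: "\<And>t. card (insert b A \<inter> {..t}) \<le> card (C \<inter> {..t})"
    using assms \<open>b \<notin> A\<close> by (auto simp: dominated_def)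
  show "C \<noteq> {}" using card by auto
  then have Max: "Max C \<in> C" using fin by simp
  have "C \<subseteq> {1..Max C}" using fin \<open>0 \<notin> C\<close> by (auto simp: Suc_le_eq intro: gr0I)
  then have "card A + 1 \<le> Max C" using card card_mono[of "{1..Max C}" C] by simp
  moreover have "Max C \<le> b"
  proof -
    have "insert b A \<inter> {..b} = insert b A" using assms(2) by force
    then have "card C \<le> card (C \<inter> {..b})" using le[of b] card assms(1) \<open>b \<notin> A\<close> by simp
    then have "C \<inter> {..b} = C" using fin by (intro card_seteq) auto
    then show ?thesis using Max by auto
  qed
  ultimately show "Max C \<in> {card A + 1..b}" by simp
  \<comment> \<open>Below \<open>Max C\<close> the removal changes nothing; from
    \<open>Max C\<close> on, all \<open>card A\<close> remaining elements are counted.\<close>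
  have "card (A \<inter> {..t}) \<le> card ((C - {Max C}) \<inter> {..t})" for t
  proof (cases "t < Max C")
    case True
    then have "(C - {Max C}) \<inter> {..t} = C \<inter> {..t}" by auto
    moreover have "card (A \<inter> {..t}) \<le> card (insert b A \<inter> {..t})"
      using assms(1) by (intro card_mono) auto
    ultimately show ?thesis using le[of t] by simp
  next
    case False
    then have "C \<subseteq> {..t}" using Max_ge[OF fin] by (meson atMost_iff le_trans not_less subsetI)
    then have "(C - {Max C}) \<inter> {..t} = C - {Max C}" by auto
    moreover have "card (A \<inter> {..t}) \<le> card A" using assms(1) by (intro card_mono) auto
    ultimately show ?thesis using card Max fin by simp
  qed
  then show "C - {Max C} \<in> dominated A"
    using fin \<open>0 \<notin> C\<close> card Max by (simp add: dominated_def)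
qed

text \<open>Induction on the largest element of \<open>X\<close>: \<open>C\<close> is determined by
  its maximum and the rest. If \<open>x\<close> has rank \<open>m\<close> in \<open>X\<close>, its
  factor is the size of \<open>{m..x}\<close>, the range allowed for the \<open>m\<close>-th
  smallest element of \<open>C\<close>.\<close>

lemma card_dominated_le:
  assumes "finite X" "0 \<notin> X"
  shows "finite (dominated X)"
    and "card (dominated X) \<le> (\<Prod>x\<in>X. x - card (X \<inter> {..x}) + 1)"
proof -
  have "finite (dominated X) \<and> card (dominated X) \<le> (\<Prod>x\<in>X. x - card (X \<inter> {..x}) + 1)"
    using assms
  proof (induction rule: finite_linorder_max_induct)
    case empty
    have "dominated {} = {{}}" by (auto simp: dominated_def)
    then show ?case by simp
  next
    case (insert b A)
    let ?f = "\<lambda>C. (C - {Max C}, Max C)"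
    have lt: "\<forall>a\<in>A. a < b" and "b \<notin> A" using insert.hyps by auto
    note Max = dominated_insert_Max[OF insert.hyps(1) lt]
    have IH: "finite (dominated A)" "card (dominated A) \<le> (\<Prod>x\<in>A. x - card (A \<inter> {..x}) + 1)"
      using insert by auto
    have inj: "inj_on ?f (dominated (insert b A))"
    proof (rule inj_onI)
      fix C C' assume C: "C \<in> dominated (insert b A)" "C' \<in> dominated (insert b A)" "?f C = ?f C'"
      have "Max C \<in> C" "Max C' \<in> C'"
        using Max(1)[OF C(1)] Max(1)[OF C(2)] C(1,2) by (auto simp: dominated_def)
      then show "C = C'" using C(3) by (metis Pair_inject insert_Diff)
    qed
    have sub: "?f ` dominated (insert b A) \<subseteq> dominated A \<times> {card A + 1..b}"
      using Max(2,3) by auto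
    have fin: "finite (dominated A \<times> {card A + 1..b})" using IH(1) by simp
    \<comment> \<open>Positivity of the elements gives \<open>card A < b\<close>, so that the
      truncated subtraction in the factor for \<open>b\<close> is a true one.\<close>
    have "A \<subseteq> {1..<b}" using lt insert.prems by (auto simp: Suc_le_eq intro: gr0I)
    then have "card A < b" using card_mono[of "{1..<b}" A] insert.prems by (cases b) auto
    have "card (dominated (insert b A)) \<le> card (dominated A) * (b - card A)"
      using card_inj_on_le[OF inj sub fin] by (simp add: card_cartesian_product)
    also have "\<dots> \<le> (\<Prod>x\<in>A. x - card (A \<inter> {..x}) + 1) * (b - card A)"
      using IH(2) by simp
    also have "(\<Prod>x\<in>A. x - card (A \<inter> {..x}) + 1)
        = (\<Prod>x\<in>A. x - card (insert b A \<inter> {..x}) + 1)"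
    proof (rule prod.cong)
      fix x assume "x \<in> A"
      then have "insert b A \<inter> {..x} = A \<inter> {..x}" using lt by force
      then show "x - card (A \<inter> {..x}) + 1 = x - card (insert b A \<inter> {..x}) + 1" by simp
    qed simp
    also have "b - card A = b - card (insert b A \<inter> {..b}) + 1"
    proof -
      have "insert b A \<inter> {..b} = insert b A" using lt by force
      then show ?thesis using insert.hyps(1) \<open>b \<notin> A\<close> \<open>card A < b\<close> by simp
    qed
    finally have "card (dominated (insert b A))
        \<le> (\<Prod>x\<in>insert b A. x - card (insert b A \<inter> {..x}) + 1)"
      using insert.hyps(1) \<open>b \<notin> A\<close> by (simp add: mult.commute)
    then show ?case using finite_imageD[OF finite_subset[OF sub fin] inj] by simp
  qed
  then show "finite (dominated X)"
    and "card (dominated X) \<le> (\<Prod>x\<in>X. x - card (X \<inter> {..x}) + 1)" by auto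
qed

section \<open>Inversions and the numbers R\<close>

definition inverted :: "(nat \<Rightarrow> nat) \<Rightarrow> nat \<Rightarrow> nat set" where
  "inverted w y = {x. x < y \<and> inv w y < inv w x}"

lemma finite_inverted [simp]: "finite (inverted w y)"
  by (rule finite_subset[of _ "{..<y}"]) (auto simp: inverted_def)

context
  fixes n :: nat and w :: "nat \<Rightarrow> nat"
  assumes w: "w permutes {1..n}"
begin

lemma inv_le: "x \<le> n \<Longrightarrow> inv w x \<le> n"
  using permutes_in_image[OF permutes_inv[OF w], of x] permutes_not_in[OF permutes_inv[OF w], of x]
  by (cases "x \<in> {1..n}") auto

lemma inv_fixed: "n < x \<Longrightarrow> inv w x = x"
  using permutes_not_in[OF permutes_inv[OF w], of x] by simp

lemma zero_fixed: "w 0 = 0" "inv w 0 = 0"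
  using permutes_not_in[OF w, of 0] permutes_not_in[OF permutes_inv[OF w], of 0] by auto

lemma inv_ge_1: "1 \<le> x \<Longrightarrow> 1 \<le> inv w x"
  by (metis gr0I less_one not_le permutes_inverses(1)[OF w] zero_fixed(1))

lemma w_ge_1: "1 \<le> i \<Longrightarrow> 1 \<le> w i"
  by (metis gr0I less_one not_le permutes_inverses(2)[OF w] zero_fixed(2))

lemma inverted_bounds:
  assumes "x \<in> inverted w y"
  shows "1 \<le> x" "x < y" "y \<le> n"
proof -
  have lt: "x < y" "inv w y < inv w x" using assms by (auto simp: inverted_def)
  then show "1 \<le> x" using zero_fixed by (cases x) auto
  show "x < y" by fact
  show "y \<le> n"
  proof (rule ccontr)
    assume "\<not> y \<le> n"
    then show False using lt inv_fixed[of y] inv_fixed[of x] inv_le[of x] by (cases "x \<le> n") auto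
  qed
qed

lemma inversions_on_inv: "inversions_on {1..n} (inv w) = {(x, y). x \<in> inverted w y}"
proof -
  have "(x, y) \<in> inversions_on {1..n} (inv w)" if "x \<in> inverted w y" for x y
    using inverted_bounds[OF that] that by (simp add: inversions_on_def inverted_def)
  then show ?thesis by (auto simp: inversions_on_def inverted_def)
qed

lemma bij_betw_inversions:
  "bij_betw (\<lambda>(y, x). (x, y)) (SIGMA y:{1..n}. inverted w y) (inversions_on {1..n} (inv w))"
  unfolding inversions_on_inv
proof (rule bij_betwI[where g = "\<lambda>(x, y). (y, x)"])
  show "(\<lambda>(x, y). (y, x)) \<in> {(x, y). x \<in> inverted w y} \<rightarrow> (SIGMA y:{1..n}. inverted w y)"
  proof clarsimp
    fix x y assume "x \<in> inverted w y"
    then show "Suc 0 \<le> y \<and> y \<le> n" using inverted_bounds[of x y] by simp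
  qed
qed auto

lemma sum_inversions:
  "(\<Sum>(x, y)\<in>inversions_on {1..n} (inv w). f x y) = (\<Sum>y\<in>{1..n}. \<Sum>x\<in>inverted w y. f x y :: nat)"
  using sum.reindex_bij_betw[OF bij_betw_inversions, of "\<lambda>(x, y). f x y"]
  by (simp add: sum.Sigma case_prod_beta')

lemma prod_inversions:
  "(\<Prod>(x, y)\<in>inversions_on {1..n} (inv w). f x y) = (\<Prod>y\<in>{1..n}. \<Prod>x\<in>inverted w y. f x y :: nat)"
  using prod.reindex_bij_betw[OF bij_betw_inversions, of "\<lambda>(x, y). f x y"]
  by (simp add: prod.Sigma case_prod_beta')

text \<open>\<open>RPD\<close> counts inversions of \<open>w\<close>, whereas crossings correspond
  to those of its inverse; exchanging positions and values matches the two.\<close>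

lemma card_inversions:
  "card (inversions_on {1..} w) = card (inversions_on {1..n} (inv w))"
proof (rule bij_betw_same_card)
  show "bij_betw (\<lambda>(i, k). (w k, w i)) (inversions_on {1..} w) (inversions_on {1..n} (inv w))"
    unfolding inversions_on_inv
  proof (rule bij_betwI[where g = "\<lambda>(x, y). (inv w y, inv w x)"])
    show "(\<lambda>(x, y). (inv w y, inv w x)) \<in> {(x, y). x \<in> inverted w y} \<rightarrow> inversions_on {1..} w"
    proof clarsimp
      fix x y assume "x \<in> inverted w y"
      then show "(inv w y, inv w x) \<in> inversions_on {Suc 0..} w"
        using inverted_bounds[of x y] inv_ge_1[of x] inv_ge_1[of y]
        by (simp add: inverted_def inversions_on_def permutes_inverses[OF w])
    qed
  qed (auto simp: inverted_def inversions_on_def permutes_inverses[OF w])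
qed

text \<open>Each pipe \<open>z \<le> x\<close> differs from \<open>y\<close>, as
  \<open>x < y\<close>. It exits either above \<open>y\<close>, and is then counted by
  \<open>R\<close>, or below \<open>y\<close>, and is then inverted with \<open>y\<close>.\<close>

lemma R_plus_card_inverted:
  assumes "x \<in> inverted w y"
  shows "R w x y + card (inverted w y \<inter> {..x}) = x"
proof -
  let ?A = "{z \<in> {1..x}. inv w z < inv w y}"
  have "bij_betw w {i \<in> {1..}. i < inv w y \<and> w i \<le> x} ?A"
    by (rule bij_betwI[where g = "inv w"])
      (use w_ge_1 inv_ge_1 in \<open>auto simp: permutes_inverses[OF w]\<close>)
  then have R: "R w x y = card ?A" unfolding R_def by (rule bij_betw_same_card)
  have Un: "?A \<union> (inverted w y \<inter> {..x}) = {1..x}"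
  proof -
    have "inv w z \<noteq> inv w y" if "z \<le> x" for z
      using that inverted_bounds(2)[OF assms] permutes_inverses(1)[OF w] by (metis leD)
    then have "inv w z < inv w y \<or> z \<in> inverted w y" if "z \<le> x" for z
      using that inverted_bounds(2)[OF assms] by (force simp: inverted_def)
    moreover have "1 \<le> z" if "z \<in> inverted w y" for z using inverted_bounds(1)[OF that] .
    ultimately show ?thesis by (intro set_eqI) (simp, blast)
  qed
  have disj: "?A \<inter> (inverted w y \<inter> {..x}) = {}" by (auto simp: inverted_def)
  have "R w x y + card (inverted w y \<inter> {..x}) = card (?A \<union> (inverted w y \<inter> {..x}))"
    unfolding R by (rule card_Un_disjoint[symmetric]) (use disj in auto)
  also have "\<dots> = x" unfolding Un by simp
  finally show ?thesis .
qed

section \<open>Crosses of reduced pipe dreams and the upper bound\<close>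

lemma RPD_exit:
  assumes "D \<in> RPD w" "1 \<le> y"
  shows "on_pipe D y (Ver (inv w y) 0)"
  using on_pipe_pd_perm[of D "inv w y"] assms inv_ge_1[of y]
  by (simp add: RPD_def permutes_inverses[OF w])

text \<open>Every inversion forces a cross, and distinct inversions force distinct crosses.
  Reducedness makes the numbers equal, so no further crosses exist.\<close>

lemma RPD_crossings:
  assumes "D \<in> RPD w"
  obtains g where "bij_betw g (inversions_on {1..n} (inv w)) D"
    and "\<And>x y. x \<in> inverted w y \<Longrightarrow> crosses D x y (g (x, y))"
proof -
  let ?I = "inversions_on {1..n} (inv w)"
  have "\<exists>t. crosses D (fst p) (snd p) t" if I: "p \<in> ?I" for p
  proof -
    obtain x y where p: "p = (x, y)" "x \<in> inverted w y"
      using I unfolding inversions_on_inv by auto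
    then show ?thesis
      using inverted_pipes_cross[OF RPD_exit[OF assms] RPD_exit[OF assms], of x y]
        inverted_bounds[OF p(2)] by (simp add: inverted_def)
  qed
  then obtain g where g: "\<And>p. p \<in> ?I \<Longrightarrow> crosses D (fst p) (snd p) (g p)"
    using bchoice[of ?I "\<lambda>p. crosses D (fst p) (snd p)"] by blast
  have "inj_on g ?I"
  proof (rule inj_onI)
    fix p q assume "p \<in> ?I" "q \<in> ?I" "g p = g q"
    then show "p = q" using crosses_unique g by (metis prod.expand)
  qed
  moreover have "g ` ?I = D"
  proof (rule card_subset_eq)
    show "finite D" using assms by (simp add: RPD_def pipe_dream_def)
    show "g ` ?I \<subseteq> D" using g by (force simp: crosses_def)
    show "card (g ` ?I) = card D"
      using assms card_image[OF \<open>inj_on g ?I\<close>] by (simp add: RPD_def card_inversions del: One_nat_def)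
  qed
  ultimately show ?thesis
    using that[of g] g unfolding bij_betw_def inversions_on_inv by auto
qed

text \<open>In particular, at every cross the vertical pipe has the smaller label.\<close>

lemma RPD_tile:
  assumes "D \<in> RPD w" "t \<in> D"
  obtains x y where "x \<in> inverted w y" "crosses D x y t"
proof -
  obtain g where g: "bij_betw g (inversions_on {1..n} (inv w)) D"
      "\<And>x y. x \<in> inverted w y \<Longrightarrow> crosses D x y (g (x, y))"
    using RPD_crossings[OF assms(1)] by blast
  then obtain x y where "x \<in> inverted w y" "t = g (x, y)"
    using assms(2) unfolding bij_betw_def inversions_on_inv by auto
  then show ?thesis using that g(2) by blast
qed

text \<open>A pipe inverted with \<open>y\<close> yields one horizontal cross of \<open>y\<close>,
  and that cross is recovered from its column because \<open>y\<close> passes each column boundary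
  only once.\<close>

lemma bij_betw_columns:
  assumes "bij_betw g (inversions_on {1..n} (inv w)) D"
    and g: "\<And>x y. x \<in> inverted w y \<Longrightarrow> crosses D x y (g (x, y))"
  shows "bij_betw (\<lambda>x. snd (g (x, y))) (inverted w y) (columns D y)"
proof -
  have gD: "g (x, y) \<in> D" and pipes: "on_pipe D y (Ver (fst (g (x, y))) (snd (g (x, y))))"
    if "x \<in> inverted w y" for x
    using g[OF that] by (auto simp: crosses_def)
  show ?thesis
    unfolding bij_betw_def
  proof (intro conjI inj_onI set_eqI iffI)
    fix x x' assume x: "x \<in> inverted w y" "x' \<in> inverted w y" "snd (g (x, y)) = snd (g (x', y))"
    have "fst (g (x, y)) = fst (g (x', y))"
      using pipes[OF x(1)] pipes[OF x(2)] x(3) on_pipe_Ver_unique by metis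
    then have "g (x, y) = g (x', y)" using x(3) by (rule prod_eqI)
    then show "x = x'" using crosses_unique(1) g x by metis
  next
    fix j assume "j \<in> (\<lambda>x. snd (g (x, y))) ` inverted w y"
    then show "j \<in> columns D y" using gD pipes unfolding columns_def by force
  next
    fix j assume "j \<in> columns D y"
    then obtain i where i: "(i, j) \<in> D" "on_pipe D y (Ver i j)" by (auto simp: columns_def)
    then obtain x y' where x: "x \<in> inverted w y'" "g (x, y') = (i, j)"
      using assms(1) unfolding bij_betw_def inversions_on_inv by auto
    then have "y' = y" using g[OF x(1)] i on_pipe_unique by (auto simp: crosses_def)
    then show "j \<in> (\<lambda>x. snd (g (x, y))) ` inverted w y" using x by force
  qed
qed

lemma columns_dominated:
  assumes "D \<in> RPD w"
  shows "columns D y \<in> dominated (inverted w y)"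
proof -
  obtain g where g: "bij_betw g (inversions_on {1..n} (inv w)) D"
      "\<And>x y. x \<in> inverted w y \<Longrightarrow> crosses D x y (g (x, y))"
    using RPD_crossings[OF assms] by blast
  show ?thesis
  proof (rule dominatedI[OF _ bij_betw_columns[OF g]])
    fix x assume "x \<in> inverted w y"
    then have c: "crosses D x y (g (x, y))" by (rule g(2))
    then obtain i j where ij: "g (x, y) = (i, j)" "on_pipe D x (Hor (i - 1) j)"
      by (auto simp: crosses_def)
    then show "1 \<le> snd (g (x, y)) \<and> snd (g (x, y)) \<le> x"
      using on_pipe_Hor_ge_1[OF ij(2)] edge_column_le[OF ij(2)] by simp
  qed auto
qed

lemma sum_columns:
  assumes "D \<in> RPD w"
  shows "(\<Sum>t\<in>D. snd t) = (\<Sum>y\<in>{1..n}. \<Sum>(columns D y))"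
proof -
  obtain g where g: "bij_betw g (inversions_on {1..n} (inv w)) D"
      "\<And>x y. x \<in> inverted w y \<Longrightarrow> crosses D x y (g (x, y))"
    using RPD_crossings[OF assms] by blast
  have "(\<Sum>t\<in>D. snd t) = (\<Sum>(x, y)\<in>inversions_on {1..n} (inv w). snd (g (x, y)))"
    using sum.reindex_bij_betw[OF g(1), of snd] by (simp add: case_prod_beta')
  also have "\<dots> = (\<Sum>y\<in>{1..n}. \<Sum>x\<in>inverted w y. snd (g (x, y)))"
    by (rule sum_inversions)
  also have "\<dots> = (\<Sum>y\<in>{1..n}. \<Sum>(columns D y))"
    using sum.reindex_bij_betw[OF bij_betw_columns[OF g], of "\<lambda>j. j"] by simp
  finally show ?thesis .
qed

lemma tile_if_columns_eq:
  assumes "D \<in> RPD w" "columns D y \<subseteq> columns D' y" "(i, j) \<in> D" "on_pipe D y (Ver i j)"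
    and "on_pipe D' y (Ver i j)"
  shows "(i, j) \<in> D'"
proof -
  have "j \<in> columns D' y" using assms by (auto simp: columns_def)
  then show ?thesis using assms(5) on_pipe_Ver_unique by (fastforce simp: columns_def)
qed

text \<open>On the northeasternmost diagonal \<open>c\<close> where the pipe dreams differ, the
  pipes still arrive through the same edges. A cross present in only one of them would then
  contradict the equality of the column sets of its horizontal pipe.\<close>

lemma RPD_eq_if_columns_eq:
  assumes "D \<in> RPD w" "D' \<in> RPD w" "\<And>y. y \<in> {1..n} \<Longrightarrow> columns D y = columns D' y"
  shows "D = D'"
proof (rule ccontr)
  assume "D \<noteq> D'"
  define \<Delta> where "\<Delta> = (D - D') \<union> (D' - D)"
  define c where "c = Max ((\<lambda>(i, j). int j - int i) ` \<Delta>)"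
  have "finite \<Delta>" using assms by (simp add: \<Delta>_def RPD_def pipe_dream_def)
  moreover have "\<Delta> \<noteq> {}" using \<open>D \<noteq> D'\<close> by (auto simp: \<Delta>_def)
  ultimately have "c \<in> (\<lambda>(i, j). int j - int i) ` \<Delta>" and le: "\<And>i j. (i, j) \<in> \<Delta> \<Longrightarrow> int j - int i \<le> c"
    unfolding c_def by (auto intro: Max_in Max_ge)
  then obtain i j where ij: "(i, j) \<in> \<Delta>" "int j - int i = c" by auto
  have agree: "(k, l) \<in> D \<longleftrightarrow> (k, l) \<in> D'" if "int l - int k > c" for k l
    using le[of k l] that by (auto simp: \<Delta>_def)
  have "False" if E: "E \<in> RPD w" "(i, j) \<in> E" "(i, j) \<notin> E'"
      and agr: "\<And>k l. int l - int k > c \<Longrightarrow> (k, l) \<in> E \<longleftrightarrow> (k, l) \<in> E'"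
      and col: "\<And>y. y \<in> {1..n} \<Longrightarrow> columns E y = columns E' y" for E E'
  proof -
    obtain x y where xy: "x \<in> inverted w y" "crosses E x y (i, j)" using RPD_tile[OF E(1,2)] .
    then have y: "on_pipe E y (Ver i j)" "y \<in> {1..n}"
      using inverted_bounds[OF xy(1)] by (auto simp: crosses_def)
    \<comment> \<open>The right edge of a tile on diagonal \<open>c\<close> has content
      \<open>c + 1\<close>, just inside the range of agreement.\<close>
    have "on_pipe E' y (Ver i j)"
      by (rule on_pipe_transfer[OF y(1) _ agr]) (use ij(2) in auto)
    then show False using tile_if_columns_eq[OF E(1) _ E(2) y(1), of E'] col[OF y(2)] E(3) by simp
  qed
  from this[OF assms(1) _ _ agree assms(3)] this[OF assms(2) _ _ agree[symmetric] assms(3)[symmetric]]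
  show False using ij(1) by (auto simp: \<Delta>_def)
qed

lemma card_RPD_le:
  shows "finite (RPD w)"
    and "card (RPD w) \<le> (\<Prod>(x, y)\<in>inversions_on {1..n} (inv w). R w x y + 1)"
proof -
  let ?F = "\<lambda>D. restrict (columns D) {1..n}"
  let ?P = "PiE {1..n} (\<lambda>y. dominated (inverted w y))"
  have zero: "0 \<notin> inverted w y" for y using inverted_bounds(1)[of 0 y] by auto
  have fin: "finite ?P" by (intro finite_PiE card_dominated_le zero) auto
  have sub: "?F ` RPD w \<subseteq> ?P" using columns_dominated by auto
  have inj: "inj_on ?F (RPD w)"
  proof (rule inj_onI)
    fix D D' assume D: "D \<in> RPD w" "D' \<in> RPD w" "?F D = ?F D'"
    have "columns D y = columns D' y" if "y \<in> {1..n}" for y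
      using fun_cong[OF D(3), of y] that by simp
    then show "D = D'" using RPD_eq_if_columns_eq D by blast
  qed
  show "finite (RPD w)" using finite_imageD[OF finite_subset[OF sub fin] inj] .
  have "card (RPD w) \<le> card ?P" using card_inj_on_le[OF inj sub fin] .
  also have "\<dots> = (\<Prod>y\<in>{1..n}. card (dominated (inverted w y)))" by (simp add: card_PiE)
  also have "\<dots> \<le> (\<Prod>y\<in>{1..n}. \<Prod>x\<in>inverted w y. x - card (inverted w y \<inter> {..x}) + 1)"
    by (intro prod_mono) (auto intro: card_dominated_le[OF finite_inverted zero, simplified])
  also have "\<dots> = (\<Prod>y\<in>{1..n}. \<Prod>x\<in>inverted w y. R w x y + 1)"
  proof (intro prod.cong refl)
    fix x y assume "x \<in> inverted w y"
    from R_plus_card_inverted[OF this]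
    show "x - card (inverted w y \<inter> {..x}) + 1 = R w x y + 1" by simp
  qed
  also have "\<dots> = (\<Prod>(x, y)\<in>inversions_on {1..n} (inv w). R w x y + 1)"
    by (rule prod_inversions[symmetric])
  finally show "card (RPD w) \<le> (\<Prod>(x, y)\<in>inversions_on {1..n} (inv w). R w x y + 1)" .
qed

section \<open>Lowering the sum of columns by inverse ladder moves\<close>

lemma inverse_ladder_exists:
  assumes D: "D \<in> RPD w" and "1 \<le> l" "(k, Suc l) \<in> D" "(k, l) \<notin> D"
  shows "\<exists>D' \<in> RPD w. Suc (\<Sum>t\<in>D'. snd t) = (\<Sum>t\<in>D. snd t)"
proof -
  have pd: "pipe_dream D" and fin: "finite D" and ge1: "\<And>i j. (i, j) \<in> D \<Longrightarrow> 1 \<le> i \<and> 1 \<le> j"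
    using D by (auto simp: RPD_def pipe_dream_def)
  \<comment> \<open>The rows that are not left-justified. Taking the lowest one ensures that every
    cross further down and right of column 1 has a cross to its left.\<close>
  define A where "A = {i. \<exists>j\<ge>1. (i, Suc j) \<in> D \<and> (i, j) \<notin> D}"
  define a where "a = Max A"
  have "A \<subseteq> fst ` D" by (force simp: A_def)
  then have "finite A" using fin finite_subset by blast
  moreover have "k \<in> A" using assms by (auto simp: A_def)
  ultimately have "a \<in> A" and max: "\<And>i. i \<in> A \<Longrightarrow> i \<le> a" unfolding a_def by (auto intro: Max_in)
  then obtain j where j: "1 \<le> j" "(a, Suc j) \<in> D" "(a, j) \<notin> D" by (auto simp: A_def)
  obtain j' where j': "j = Suc j'" using j(1) by (cases j) auto
  have "1 \<le> a" using ge1 j(2) by blast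
  then obtain a' where a': "a = Suc a'" by (cases a) auto
  have below: "(i, j) \<in> D" if "a < i" "(i, Suc j) \<in> D" for i
    using max[of i] that j(1) by (auto simp: A_def)
  define b where "b = (LEAST i. a < i \<and> (i, Suc j) \<notin> D)"
  have "finite (fst ` D)" using fin by simp
  then obtain N where "\<And>i. i \<in> fst ` D \<Longrightarrow> i \<le> N" by (meson finite_nat_set_iff_bounded_le)
  then have "a < Suc (a + N) \<and> (Suc (a + N), Suc j) \<notin> D" by force
  then have b: "a < b" "(b, Suc j) \<notin> D"
    using LeastI[of "\<lambda>i. a < i \<and> (i, Suc j) \<notin> D"] unfolding b_def by blast+
  have mid: "(i, j) \<in> D \<and> (i, Suc j) \<in> D" if "a < i" "i < b" for i
    using not_less_Least[of i "\<lambda>i. a < i \<and> (i, Suc j) \<notin> D"] that below by (auto simp: b_def)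
  have "(b, j) \<notin> D"
  proof
    assume bj: "(b, j) \<in> D"
    \<comment> \<open>If \<open>(b, j)\<close> were a cross, the pipes \<open>q\<close> and
      \<open>p\<close> crossing at \<open>(a, Suc j)\<close> would run down side by side and cross
      again at \<open>(b, j)\<close> with exchanged roles. Then both \<open>q < p\<close> and
      \<open>p < q\<close> would hold.\<close>
    obtain q p where qp: "q \<in> inverted w p" "crosses D q p (a, Suc j)" using RPD_tile[OF D j(2)] .
    have start: "on_pipe D q (Hor a (Suc j))" "on_pipe D p (Hor a j)"
      using qp(2) j cross_top[of D q a' "Suc j"] cross_right[of D p a j] bump_right[of D p a j']
      by (auto simp: crosses_def a' j')
    have down: "on_pipe D q (Hor i (Suc j)) \<and> on_pipe D p (Hor i j)" if "a \<le> i" "i < b" for i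
      using that
    proof (induction rule: dec_induct)
      case (step i)
      then show ?case using mid[of "Suc i"] by (auto intro: cross_top)
    qed (use start in auto)
    obtain b' where b': "b = Suc b'" using b(1) by (cases b) auto
    have "crosses D p q (b, j)"
      using down[of b'] b bj bump_top[of D q b' j] by (auto simp: crosses_def b')
    moreover obtain x y where "x \<in> inverted w y" "crosses D x y (b, j)" using RPD_tile[OF D bj] .
    ultimately show False
      using crosses_unique inverted_bounds(2)[OF qp(1)] inverted_bounds(2)[of x y] by (metis less_asym)
  qed
  define D' where "D' = insert (b, j) (D - {(a, Suc j)})"
  have pd': "pipe_dream D'"
    using pd b(1) j(1) by (auto simp: D'_def pipe_dream_def)
  have "on_pipe D' (w i) (Ver i 0)" if "1 \<le> i" for i
  proof -
    have "on_pipe D (w i) (Ver i 0)" using on_pipe_pd_perm[OF pd that] D by (simp add: RPD_def)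
    from on_pipe_inverse_ladder[OF b(1) j(1) \<open>1 \<le> a\<close> j(3,2) \<open>(b, j) \<notin> D\<close> b(2) mid D'_def this]
    show ?thesis using j(1) by (simp add: ladder_edge_def)
  qed
  then have "pd_perm D' i = w i" for i
    using pd_perm_eqI[OF pd', of i] zero_fixed(1) by (cases "i = 0") (auto simp: pd_perm_def)
  moreover have "card D' = card D"
    using fin \<open>(b, j) \<notin> D\<close> j(2) card.remove[of D "(a, Suc j)"] by (simp add: D'_def)
  ultimately have "D' \<in> RPD w" using D pd' by (auto simp: RPD_def)
  moreover have "Suc (\<Sum>t\<in>D'. snd t) = (\<Sum>t\<in>D. snd t)"
    using fin \<open>(b, j) \<notin> D\<close> j(2) sum.remove[of D "(a, Suc j)" snd] by (simp add: D'_def)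
  ultimately show ?thesis by blast
qed

lemma sum_left_justified:
  assumes D: "D \<in> RPD w" and left: "\<And>i j. 1 \<le> j \<Longrightarrow> (i, Suc j) \<in> D \<Longrightarrow> (i, j) \<in> D"
  shows "(\<Sum>t\<in>D. snd t) = (\<Sum>y\<in>{1..n}. \<Sum>{1..card (inverted w y)})"
proof -
  have "columns D y = {1..card (inverted w y)}" for y
  proof -
    have fin: "finite (columns D y)" "0 \<notin> columns D y" "card (columns D y) = card (inverted w y)"
      using columns_dominated[OF D, of y] by (auto simp: dominated_def)
    \<comment> \<open>Pipe \<open>y\<close> leaves its cross in column \<open>Suc j\<close> to the
      left, and the tile it enters there is a cross by left-justification.\<close>
    have "j \<in> columns D y" if "1 \<le> j" "Suc j \<in> columns D y" for j
      using that left[of j] cross_right by (fastforce simp: columns_def)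
    then have "columns D y = {1..card (columns D y)}"
      using downward_closed_eq_atLeastAtMost[OF fin(1,2)] by blast
    then show ?thesis using fin(3) by simp
  qed
  then show ?thesis using sum_columns[OF D] by simp
qed

text \<open>As long as the sum exceeds \<open>s\<close>, it exceeds the left-justified value, so an
  inverse ladder move applies and lowers it by exactly one.\<close>

lemma RPD_sum_attained:
  assumes "D \<in> RPD w" "(\<Sum>y\<in>{1..n}. \<Sum>{1..card (inverted w y)}) \<le> s" "s \<le> (\<Sum>t\<in>D. snd t)"
  shows "\<exists>D'\<in>RPD w. (\<Sum>t\<in>D'. snd t) = s"
  using assms
proof (induction "\<Sum>t\<in>D. snd t" arbitrary: D)
  case 0
  then show ?case by (intro bexI[of _ D]) auto
next
  case (Suc m)
  show ?case
  proof (cases "s = Suc m")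
    case True
    then show ?thesis using Suc by (intro bexI[of _ D]) auto
  next
    case False
    then obtain l k where "1 \<le> l" "(k, Suc l) \<in> D" "(k, l) \<notin> D"
      using sum_left_justified[OF Suc.prems(1)] Suc.prems(2,3) Suc.hyps(2) by force
    then obtain D' where "D' \<in> RPD w" "Suc (\<Sum>t\<in>D'. snd t) = Suc m"
      using inverse_ladder_exists[OF Suc.prems(1)] Suc.hyps(2) by metis
    then show ?thesis using Suc.hyps(1)[of D'] Suc.prems False Suc.hyps(2) by simp
  qed
qed

section \<open>The top-justified pipe dream\<close>

text \<open>\<open>card (later x x)\<close> is the entry at \<open>x\<close> of the Lehmer code of the inverse of \<open>w\<close>.\<close>

definition later :: "nat \<Rightarrow> nat \<Rightarrow> nat set" where
  "later z x = {y. z < y \<and> inv w y < inv w x}"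

definition top_dream :: "(nat \<times> nat) set" where
  "top_dream = (\<lambda>(x, i). (i, x)) ` (SIGMA x:{1..n}. {1..card (later x x)})"

lemma finite_later [simp]: "finite (later z x)"
proof (rule finite_subset)
  show "later z x \<subseteq> w ` {..<inv w x}"
  proof
    fix y assume "y \<in> later z x"
    then show "y \<in> w ` {..<inv w x}"
      using permutes_inverses(1)[OF w, of y] by (intro image_eqI[of _ _ "inv w y"]) (auto simp: later_def)
  qed
qed simp

lemma inverted_iff_later: "x \<in> inverted w y \<longleftrightarrow> y \<in> later x x"
  by (simp add: inverted_def later_def)

lemma top_dream_iff: "(i, x) \<in> top_dream \<longleftrightarrow> 1 \<le> i \<and> i \<le> card (later x x)"
proof -
  have "x \<in> {1..n}" if pos: "1 \<le> card (later x x)"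
  proof -
    obtain y where "y \<in> later x x" using pos by fastforce
    then show ?thesis using inverted_bounds[of x y] by (simp add: inverted_iff_later)
  qed
  then show ?thesis by (auto simp: top_dream_def)
qed

lemma on_pipe_top_dream_down:
  assumes "1 \<le> x" "k \<le> card (later x x)"
  shows "on_pipe top_dream x (Hor k x)"
  using assms(2)
proof (induction k)
  case 0
  then show ?case using on_pipe.enter[OF assms(1)] by simp
next
  case (Suc k)
  then show ?case by (intro cross_top) (auto simp: top_dream_iff)
qed

text \<open>Going left from column \<open>x\<close>, pipe \<open>x\<close> drops one row for each
  pipe \<open>y > z\<close> that exits above it. At \<open>z = 0\<close> this gives its exit
  row.\<close>

lemma on_pipe_top_dream:
  assumes "z < x"
  shows "on_pipe top_dream x (Ver (Suc (card (later z x))) z)"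
proof -
  obtain x' where x': "x = Suc x'" using assms by (cases x) auto
  have "later x' x = later x x"
  proof (intro set_eqI)
    fix y show "y \<in> later x' x \<longleftrightarrow> y \<in> later x x" by (cases "y = x") (auto simp: later_def x')
  qed
  then have last: "on_pipe top_dream x (Ver (Suc (card (later x' x))) x')"
    using bump_top[of top_dream x "card (later x x)" x'] on_pipe_top_dream_down[of x "card (later x x)"]
    by (simp add: x' top_dream_iff)
  have "z \<le> x'" using assms x' by simp
  then show ?thesis
  proof (induction rule: inc_induct)
    case base
    show ?case by (rule last)
  next
    case (step z)
    let ?r = "Suc (card (later (Suc z) x))"
    show ?case
    proof (cases "inv w x < inv w (Suc z)")
      case True
      then have "later z x = later (Suc z) x"
      proof (intro set_eqI)
        fix y show "y \<in> later z x \<longleftrightarrow> y \<in> later (Suc z) x"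
          using True by (cases "y = Suc z") (auto simp: later_def)
      qed
      \<comment> \<open>Pipe \<open>Suc z\<close> exits below \<open>x\<close>, hence below
        everything that exits above \<open>x\<close>. The crosses of column \<open>Suc z\<close>
        thus reach down to row \<open>?r\<close>, and \<open>x\<close> goes straight
        through.\<close>
      moreover have "insert x (later (Suc z) x) \<subseteq> later (Suc z) (Suc z)"
        using True step.hyps x' by (auto simp: later_def)
      then have "?r \<le> card (later (Suc z) (Suc z))"
        using card_mono[of "later (Suc z) (Suc z)" "insert x (later (Suc z) x)"]
          card_insert_disjoint[OF finite_later[of "Suc z" x], of x]
        by (simp add: later_def[of "Suc z" x])
      ultimately show ?thesis using step.IH by (auto intro: cross_right simp: top_dream_iff)
    next
      case False
      then have lt: "inv w (Suc z) < inv w x"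
      proof -
        have "Suc z \<noteq> x" using step.hyps x' by simp
        then have "inv w (Suc z) \<noteq> inv w x" by (metis permutes_inverses(1)[OF w])
        then show ?thesis using False by simp
      qed
      then have "later z x = insert (Suc z) (later (Suc z) x)"
        by (intro set_eqI) (auto simp: later_def)
      moreover have "Suc z \<notin> later (Suc z) x" by (simp add: later_def)
      ultimately have "card (later z x) = ?r" by simp
      \<comment> \<open>Now column \<open>Suc z\<close> has its last cross above row
        \<open>?r\<close>, so \<open>x\<close> meets two bumps there and ends one row lower.\<close>
      moreover have "card (later (Suc z) (Suc z)) \<le> card (later (Suc z) x)"
        by (rule card_mono[OF finite_later]) (use lt in \<open>auto simp: later_def\<close>)
      ultimately show ?thesis
        using step.IH bump_right[of top_dream x ?r z] bump_top[of top_dream x ?r z]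
        by (simp add: top_dream_iff)
    qed
  qed
qed

lemma top_dream_in_RPD: "top_dream \<in> RPD w"
proof -
  have pd: "pipe_dream top_dream" by (auto simp: pipe_dream_def top_dream_def)
  have "on_pipe top_dream x (Ver (inv w x) 0)" if "1 \<le> x" for x
  proof -
    have "bij_betw w {1..<inv w x} (later 0 x)"
      by (rule bij_betwI[where g = "inv w"])
        (use w_ge_1 inv_ge_1 in \<open>auto simp: later_def permutes_inverses[OF w] Suc_le_eq\<close>)
    then have "card (later 0 x) = inv w x - 1" using bij_betw_same_card by fastforce
    then show ?thesis using on_pipe_top_dream[of 0 x] inv_ge_1[OF that] that by simp
  qed
  then have "pd_perm top_dream i = w i" for i
    using pd_perm_eqI[OF pd, of i "w i"] w_ge_1[of i] zero_fixed(1)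
    by (cases "i = 0") (auto simp: pd_perm_def permutes_inverses[OF w] dest: meta_spec[of _ "w i"])
  moreover have "card top_dream = card (inversions_on {1..} w)"
  proof -
    have "inversions_on {1..n} (inv w) = (SIGMA x:{1..n}. later x x)"
      using inverted_bounds unfolding inversions_on_inv by (force simp: inverted_iff_later)
    then have "card (inversions_on {1..} w) = (\<Sum>x\<in>{1..n}. card (later x x))"
      by (simp add: card_inversions del: One_nat_def)
    also have "\<dots> = card top_dream"
      unfolding top_dream_def by (subst card_image) (auto simp: inj_on_def)
    finally show ?thesis ..
  qed
  ultimately show ?thesis using pd by (auto simp: RPD_def)
qed

section \<open>The two extreme sums and the lower bound\<close>

lemma sum_top_dream:
  "(\<Sum>t\<in>top_dream. snd t) = (\<Sum>(x, y)\<in>inversions_on {1..n} (inv w). x)"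
proof -
  have "(\<Sum>t\<in>top_dream. snd t) = (\<Sum>p\<in>(SIGMA x:{1..n}. {1..card (later x x)}). fst p)"
    unfolding top_dream_def by (subst sum.reindex) (auto simp: inj_on_def case_prod_beta')
  also have "\<dots> = (\<Sum>x\<in>{1..n}. card (later x x) * x)"
    by (simp add: sum.Sigma[of _ _ "\<lambda>x y. x", symmetric, unfolded case_prod_beta'])
  also have "\<dots> = (\<Sum>p\<in>(SIGMA x:{1..n}. later x x). fst p)"
    by (simp add: sum.Sigma[of _ _ "\<lambda>x y. x", symmetric, unfolded case_prod_beta'])
  also have "(SIGMA x:{1..n}. later x x) = inversions_on {1..n} (inv w)"
    using inverted_bounds unfolding inversions_on_inv by (force simp: inverted_iff_later)
  finally show ?thesis by (simp add: case_prod_beta')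
qed

lemma le_card_RPD: "1 + (\<Sum>(x, y)\<in>inversions_on {1..n} (inv w). R w x y) \<le> card (RPD w)"
proof -
  let ?B = "\<Sum>y\<in>{1..n}. \<Sum>{1..card (inverted w y)}"
  let ?S = "\<Sum>(x, y)\<in>inversions_on {1..n} (inv w). R w x y"
  have "(\<Sum>t\<in>top_dream. snd t) = (\<Sum>y\<in>{1..n}. \<Sum>x\<in>inverted w y. x)"
    unfolding sum_top_dream by (rule sum_inversions)
  also have "\<dots> = (\<Sum>y\<in>{1..n}. \<Sum>x\<in>inverted w y. R w x y + card (inverted w y \<inter> {..x}))"
    by (intro sum.cong refl R_plus_card_inverted[symmetric])
  \<comment> \<open>The ranks of the elements of each \<open>inverted w y\<close> add up to the
    left-justified sum \<open>?B\<close>.\<close>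
  also have "\<dots> = ?S + ?B"
    unfolding sum_inversions sum.distrib by (simp add: sum_card_atMost)
  \<comment> \<open>All \<open>?S + 1\<close> integers in this interval are sums of columns of
    reduced pipe dreams.\<close>
  finally have "{?B..?S + ?B} \<subseteq> (\<lambda>D. \<Sum>t\<in>D. snd t) ` RPD w"
    using RPD_sum_attained[OF top_dream_in_RPD] by force
  then have "card {?B..?S + ?B} \<le> card (RPD w)"
    using card_RPD_le(1) by (rule surj_card_le[rotated])
  then show ?thesis by simp
qed

end

theorem corollary5p9:
  fixes n :: nat and w :: "nat \<Rightarrow> nat"
  assumes "w permutes {1..n}"
  shows "1 + (\<Sum>(x, y)\<in>inversions_on {1..n} (inv w). R w x y) \<le> card (RPD w)
       \<and> card (RPD w) \<le> (\<Prod>(x, y)\<in>inversions_on {1..n} (inv w). R w x y + 1)"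
  using le_card_RPD[OF assms] card_RPD_le(2)[OF assms] ..

end
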